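(* Let $N$ be the number of phases and, for $1\le q\le N$, let $\alpha_q,\gamma_q,P_q,P_q^\infty$ be real numbers with $0\le\alpha_q\le 1$, $\sum_{q=1}^N\alpha_q=1$, $\gamma_q>1$ and $P_q\ge P_q^{\min}:=-P_q^\infty$. Define $$\mathcal F^P(\mathcal P)=\sum_{q=1}^N\frac{\mathcal P-P_q}{\mathcal P+P_q^\infty}\,\frac{\alpha_q}{\gamma_q}.$$ Then the largest root of $\mathcal F^P(\mathcal P)=0$ is in $$\Big[\min_q P_q,\ \max_q P_q\Big]\cup\Big(\max_q P_q^{\min},\ \max_q P_q\Big].$$
   Context: Setting: an $N$-phase mixture. Phase $q$ has volume fraction $\alpha_q$, pressure $P_q$, density $\rho_q$ and specific internal energy $e_q$, with equation of state $\rho_q(e_q-e_q^\infty)=\frac{P_q+\gamma_q P_q^\infty}{\gamma_q-1}$, where $\gamma_q$, $P_q^\infty$, $e_q^\infty$ are material-dependent parameters. The number $P_q^{\min}=-P_q^\infty$ is the minimal admissible pressure of phase $q$. The state before relaxation is assumed thermodynamically admissible, which gives the stated inequalities on $\alpha_q$ and $P_q$. The common pressure after instantaneous pressure relaxation is a zero of $\mathcal F^P$. Minima and maxima are over $1\le q\le N$.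
   Formalization: A point where a term with nonzero volume fraction is 0/0 (pressure equal to its minimal pressure) and no such term has a pole is counted as a root, since otherwise the claim fails; phases with zero volume fraction contribute zero everywhere. *)

theory Defs
  imports Complex_Main
begin

definition Pmin :: "(nat \<Rightarrow> real) \<Rightarrow> nat \<Rightarrow> real" where
  "Pmin Pinf q = - Pinf q"

definition FP ::
  "nat \<Rightarrow> (nat \<Rightarrow> real) \<Rightarrow> (nat \<Rightarrow> real) \<Rightarrow> (nat \<Rightarrow> real) \<Rightarrow> (nat \<Rightarrow> real) \<Rightarrow> real \<Rightarrow> real"
where
  "FP N \<alpha> \<gamma> P Pinf x = (\<Sum>q = 1..N. (x - P q) / (x + Pinf q) * (\<alpha> q / \<gamma> q))"

(* Roots of FP(x) = 0, with the points where a denominator vanishes treated explicitly, because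
   HOL's x / 0 = 0 would give FP a meaningless value there.
   - A phase with alpha_q = 0 contributes the zero term and hence no singularity.
   - Where no denominator of a present phase vanishes, a root is just a zero of FP.
   - A pole (vanishing denominator, nonvanishing numerator) of a present phase is never a root.
   - If P_q = Pmin_q is allowed, the term of phase q is 0/0 at x = Pmin_q.  If this happens for some
     present phase and no present phase has a pole at x, then x counts as a root: the
     indeterminate quotient, i.e. any r with r * (x + Pinf_q) = x - P_q, can be chosen so that the
     sum vanishes.  Such an x is also a root after clearing denominators.
     Without this convention the localisation of the largest root fails for data such as
     N = 2, alpha = (1/2, 1/2), gamma_1 = gamma_2, P = (0, -5), Pmin = (0, -10), where the only
     zero of FP off the singular points is -15/2, below both pressures. *)
definition FP_root ::
  "nat \<Rightarrow> (nat \<Rightarrow> real) \<Rightarrow> (nat \<Rightarrow> real) \<Rightarrow> (nat \<Rightarrow> real) \<Rightarrow> (nat \<Rightarrow> real) \<Rightarrow> real \<Rightarrow> bool"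
where
  "FP_root N \<alpha> \<gamma> P Pinf x \<longleftrightarrow>
     (\<forall>q\<in>{1..N}. \<alpha> q \<noteq> 0 \<longrightarrow> x + Pinf q = 0 \<longrightarrow> x - P q = 0) \<and>
     ((\<forall>q\<in>{1..N}. \<alpha> q \<noteq> 0 \<longrightarrow> x + Pinf q \<noteq> 0) \<longrightarrow> FP N \<alpha> \<gamma> P Pinf x = 0)"

definition FP_largest_root ::
  "nat \<Rightarrow> (nat \<Rightarrow> real) \<Rightarrow> (nat \<Rightarrow> real) \<Rightarrow> (nat \<Rightarrow> real) \<Rightarrow> (nat \<Rightarrow> real) \<Rightarrow> real \<Rightarrow> bool"
where
  "FP_largest_root N \<alpha> \<gamma> P Pinf R \<longleftrightarrow>
     FP_root N \<alpha> \<gamma> P Pinf R \<and> (\<forall>x. FP_root N \<alpha> \<gamma> P Pinf x \<longrightarrow> x \<le> R)"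

lemma FP_root_regular:
  assumes "\<And>q. q \<in> {1..N} \<Longrightarrow> \<alpha> q \<noteq> 0 \<Longrightarrow> x + Pinf q \<noteq> 0"
  shows "FP_root N \<alpha> \<gamma> P Pinf x \<longleftrightarrow> FP N \<alpha> \<gamma> P Pinf x = 0"
  using assms by (auto simp: FP_root_def)

lemma FP_root_strict:
  assumes "\<And>q. q \<in> {1..N} \<Longrightarrow> \<alpha> q \<noteq> 0 \<Longrightarrow> Pmin Pinf q < P q"
  shows "FP_root N \<alpha> \<gamma> P Pinf x \<longleftrightarrow>
    (\<forall>q\<in>{1..N}. \<alpha> q \<noteq> 0 \<longrightarrow> x + Pinf q \<noteq> 0) \<and> FP N \<alpha> \<gamma> P Pinf x = 0"
  using assms unfolding FP_root_def Pmin_def by fastforce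

lemma FP_root_quotients:
  assumes "\<And>q. q \<in> {1..N} \<Longrightarrow> \<gamma> q > 1"
  shows "FP_root N \<alpha> \<gamma> P Pinf x \<longleftrightarrow>
    (\<exists>r. (\<forall>q\<in>{1..N}. \<alpha> q \<noteq> 0 \<longrightarrow> r q * (x + Pinf q) = x - P q) \<and>
         (\<Sum>q = 1..N. r q * (\<alpha> q / \<gamma> q)) = 0)" (is "?L \<longleftrightarrow> ?R")
proof
  assume L: ?L
  define r0 where "r0 = (\<lambda>q. (x - P q) / (x + Pinf q))"
  have r0: "\<forall>q\<in>{1..N}. \<alpha> q \<noteq> 0 \<longrightarrow> r0 q * (x + Pinf q) = x - P q"
    using L unfolding FP_root_def r0_def by auto
  show ?R
  proof (cases "\<forall>q\<in>{1..N}. \<alpha> q \<noteq> 0 \<longrightarrow> x + Pinf q \<noteq> 0")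
    case True
    then have "(\<Sum>q = 1..N. r0 q * (\<alpha> q / \<gamma> q)) = 0"
      using L unfolding FP_root_def FP_def r0_def by blast
    with r0 show ?thesis by blast
  next
    case False
    then obtain m where m: "m \<in> {1..N}" "\<alpha> m \<noteq> 0" "x + Pinf m = 0" by blast
    define s where "s = (\<Sum>q\<in>{1..N} - {m}. r0 q * (\<alpha> q / \<gamma> q))"
    define r where "r = r0(m := - s * \<gamma> m / \<alpha> m)"
    have "\<gamma> m \<noteq> 0" using assms[OF m(1)] by simp
    have "(\<Sum>q = 1..N. r q * (\<alpha> q / \<gamma> q)) =
        r m * (\<alpha> m / \<gamma> m) + (\<Sum>q\<in>{1..N} - {m}. r q * (\<alpha> q / \<gamma> q))"
      using m(1) by (simp add: sum.remove)
    also have "(\<Sum>q\<in>{1..N} - {m}. r q * (\<alpha> q / \<gamma> q)) = s"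
      unfolding s_def r_def by (rule sum.cong) auto
    also have "r m * (\<alpha> m / \<gamma> m) + s = 0"
      using m(2) \<open>\<gamma> m \<noteq> 0\<close> by (simp add: r_def)
    finally have "(\<Sum>q = 1..N. r q * (\<alpha> q / \<gamma> q)) = 0" .
    moreover have "\<forall>q\<in>{1..N}. \<alpha> q \<noteq> 0 \<longrightarrow> r q * (x + Pinf q) = x - P q"
      using r0 m by (auto simp: r_def)
    ultimately show ?thesis by blast
  qed
next
  assume ?R
  then obtain r where r: "\<forall>q\<in>{1..N}. \<alpha> q \<noteq> 0 \<longrightarrow> r q * (x + Pinf q) = x - P q"
    and s: "(\<Sum>q = 1..N. r q * (\<alpha> q / \<gamma> q)) = 0" by blast
  have "FP N \<alpha> \<gamma> P Pinf x = 0"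
    if nz: "\<forall>q\<in>{1..N}. \<alpha> q \<noteq> 0 \<longrightarrow> x + Pinf q \<noteq> 0"
  proof -
    have "FP N \<alpha> \<gamma> P Pinf x = (\<Sum>q = 1..N. r q * (\<alpha> q / \<gamma> q))"
      unfolding FP_def
    proof (rule sum.cong)
      fix q assume q: "q \<in> {1..N}"
      show "(x - P q) / (x + Pinf q) * (\<alpha> q / \<gamma> q) = r q * (\<alpha> q / \<gamma> q)"
      proof (cases "\<alpha> q = 0")
        case False
        then have "(x - P q) / (x + Pinf q) = r q"
          using nz r q by (metis nonzero_eq_divide_eq)
        then show ?thesis by simp
      qed simp
    qed simp
    with s show ?thesis by simp
  qed
  moreover have "\<forall>q\<in>{1..N}. \<alpha> q \<noteq> 0 \<longrightarrow> x + Pinf q = 0 \<longrightarrow> x - P q = 0"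
    using r by (metis mult_zero_right)
  ultimately show ?L unfolding FP_root_def by blast
qed

end

theory Submission
  imports Defs
begin

text \<open>
  Only the present phases (those with \<open>\<alpha> q \<noteq> 0\<close>) matter; let \<open>M\<close> be the largest minimal pressure
  among them. To the right of \<open>M\<close> every summand of \<open>FP\<close> is nondecreasing and has the sign of
  \<open>x - P q\<close>. Hence a root above \<open>M\<close> lies between two of the pressures, and it is the largest
  root. Suppose there is no root above \<open>M\<close>. If a phase with minimal pressure \<open>M\<close> had \<open>P q > M\<close>, then
  \<open>FP\<close> would be nonpositive just to the right of \<open>M\<close> and nonnegative at the largest pressure, so it
  would have a zero in between. Thus \<open>P q = M\<close> for all those phases, so \<open>M\<close> is a \<open>0/0\<close> root and a
  pressure.
\<close>

locale mixture =
  fixes N :: nat and \<alpha> \<gamma> P Pinf :: "nat \<Rightarrow> real"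
  assumes volume_nonneg: "q \<in> {1..N} \<Longrightarrow> 0 \<le> \<alpha> q"
    and volume_sum: "(\<Sum>q = 1..N. \<alpha> q) = 1"
    and gamma_gt_1: "q \<in> {1..N} \<Longrightarrow> \<gamma> q > 1"
    and admissible: "q \<in> {1..N} \<Longrightarrow> P q \<ge> Pmin Pinf q"
begin

definition present :: "nat set" where
  "present = {q \<in> {1..N}. \<alpha> q \<noteq> 0}"

definition M :: real where
  "M = Max (Pmin Pinf ` present)"

abbreviation F :: "real \<Rightarrow> real" where
  "F \<equiv> FP N \<alpha> \<gamma> P Pinf"

abbreviation is_root :: "real \<Rightarrow> bool" where
  "is_root \<equiv> FP_root N \<alpha> \<gamma> P Pinf"

lemma finite_present: "finite present"
  by (simp add: present_def)

lemma present_nonempty: "present \<noteq> {}"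
proof
  assume "present = {}"
  then have "(\<Sum>q = 1..N. \<alpha> q) = 0"
    by (intro sum.neutral) (auto simp: present_def)
  with volume_sum show False by simp
qed

lemma FP_eq_sum_present:
  "F x = (\<Sum>q\<in>present. (x - P q) / (x + Pinf q) * (\<alpha> q / \<gamma> q))"
  unfolding FP_def present_def by (rule sum.mono_neutral_right) auto

lemma weight_pos: "q \<in> present \<Longrightarrow> 0 < \<alpha> q / \<gamma> q"
  using volume_nonneg[of q] gamma_gt_1[of q] by (auto simp: present_def)

lemma pressure_ge: "q \<in> present \<Longrightarrow> - Pinf q \<le> P q"
  using admissible[of q] by (auto simp: present_def Pmin_def)

lemma M_ge: "q \<in> present \<Longrightarrow> - Pinf q \<le> M"
  unfolding M_def by (rule Max_ge) (auto simp: finite_present Pmin_def)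

lemma M_attained: obtains m where "m \<in> present" "- Pinf m = M"
proof -
  have "M \<in> Pmin Pinf ` present"
    unfolding M_def using finite_present present_nonempty by (intro Max_in) auto
  then show thesis using that by (auto simp: Pmin_def)
qed

lemma denominator_pos: "q \<in> present \<Longrightarrow> M < x \<Longrightarrow> 0 < x + Pinf q"
  using M_ge[of q] by linarith

lemma FP_pos:
  assumes "M < x" and "\<And>q. q \<in> present \<Longrightarrow> P q < x"
  shows "0 < F x"
  unfolding FP_eq_sum_present
  by (intro sum_pos finite_present present_nonempty mult_pos_pos[OF divide_pos_pos weight_pos])
    (use assms denominator_pos in auto)

lemma FP_neg:
  assumes "M < x" and "\<And>q. q \<in> present \<Longrightarrow> x < P q"
  shows "F x < 0"
proof -
  have "0 < (\<Sum>q\<in>present. - ((x - P q) / (x + Pinf q) * (\<alpha> q / \<gamma> q)))"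
    by (intro sum_pos finite_present present_nonempty)
      (use assms denominator_pos weight_pos in
        \<open>auto simp del: times_divide_eq_right intro!: mult_neg_pos divide_neg_pos\<close>)
  then show ?thesis
    by (simp add: FP_eq_sum_present sum_negf)
qed

text \<open>To the right of \<open>M\<close> no denominator of a present phase vanishes, so the
  convention for 0/0 does not intervene.\<close>

lemma root_above_M_iff: "M < x \<Longrightarrow> is_root x \<longleftrightarrow> F x = 0"
  by (rule FP_root_regular) (use denominator_pos in \<open>force simp: present_def\<close>)

text \<open>If \<open>x\<close> exceeded every present pressure, all summands would be positive; if
  it were below every one, all would be negative.\<close>

lemma root_above_M_between:
  assumes "M < x" "is_root x"
  obtains p r where "p \<in> present" "P p \<le> x" "r \<in> present" "x \<le> P r"
proof -
  have "F x = 0" using assms by (simp add: root_above_M_iff)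
  then show thesis
    using that FP_pos[of x] FP_neg[of x] assms(1) by (metis less_irrefl not_le_imp_less)
qed

text \<open>\<open>F\<close> does not return to zero after \<open>x\<close>: no summand decreases to
  the right of \<open>M\<close>, and one of them strictly increases.\<close>

lemma root_above_M_largest:
  assumes "M < x" "is_root x"
  shows "FP_largest_root N \<alpha> \<gamma> P Pinf x"
proof -
  have "\<not> is_root y" if "x < y" for y
  proof -
    obtain r where r: "r \<in> present" "x \<le> P r"
      using assms by (rule root_above_M_between)
    \<comment> \<open>The sign of the increment is that of \<open>P q + Pinf q\<close>.
      Admissibility makes it nonnegative, but equality is allowed and then the summand is
      constant.\<close>
    have gap: "(y - P q) / (y + Pinf q) - (x - P q) / (x + Pinf q)
        = (y - x) * (P q + Pinf q) / ((y + Pinf q) * (x + Pinf q))" if "q \<in> present" for q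
    proof -
      have "x + Pinf q \<noteq> 0" "y + Pinf q \<noteq> 0"
        using denominator_pos[OF that, of x] denominator_pos[OF that, of y] assms(1) \<open>x < y\<close>
        by auto
      then show ?thesis by (simp add: divide_simps) (simp add: algebra_simps)
    qed
    have "F x < F y"
      unfolding FP_eq_sum_present
    proof (rule sum_strict_mono_ex1[OF finite_present])
      show "\<forall>q\<in>present. (x - P q) / (x + Pinf q) * (\<alpha> q / \<gamma> q)
          \<le> (y - P q) / (y + Pinf q) * (\<alpha> q / \<gamma> q)"
      proof
        fix q assume q: "q \<in> present"
        have "0 \<le> (y - x) * (P q + Pinf q) / ((y + Pinf q) * (x + Pinf q))"
          using denominator_pos[OF q, of x] denominator_pos[OF q, of y] pressure_ge[OF q]
            assms(1) \<open>x < y\<close>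
          by (intro divide_nonneg_pos mult_nonneg_nonneg mult_pos_pos) auto
        then have "(x - P q) / (x + Pinf q) \<le> (y - P q) / (y + Pinf q)"
          using gap[OF q] by linarith
        then show "(x - P q) / (x + Pinf q) * (\<alpha> q / \<gamma> q)
            \<le> (y - P q) / (y + Pinf q) * (\<alpha> q / \<gamma> q)"
          using weight_pos[OF q] by (intro mult_right_mono) auto
      qed
      \<comment> \<open>Strictness comes from the phase \<open>r\<close>:
        \<open>P r + Pinf r\<close> is at least \<open>x + Pinf r\<close>, which is
        positive.\<close>
      have "0 < (y - x) * (P r + Pinf r) / ((y + Pinf r) * (x + Pinf r))"
        using denominator_pos[OF r(1), of x] denominator_pos[OF r(1), of y] r(2)
          assms(1) \<open>x < y\<close>
        by (intro divide_pos_pos mult_pos_pos) auto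
      then have "(x - P r) / (x + Pinf r) < (y - P r) / (y + Pinf r)"
        using gap[OF r(1)] by linarith
      then have "(x - P r) / (x + Pinf r) * (\<alpha> r / \<gamma> r)
          < (y - P r) / (y + Pinf r) * (\<alpha> r / \<gamma> r)"
        using weight_pos[OF r(1)] by (rule mult_strict_right_mono)
      then show "\<exists>q\<in>present. (x - P q) / (x + Pinf q) * (\<alpha> q / \<gamma> q)
          < (y - P q) / (y + Pinf q) * (\<alpha> q / \<gamma> q)"
        using r(1) by blast
    qed
    moreover have "F x = 0" using assms by (simp add: root_above_M_iff)
    ultimately show ?thesis
      using assms(1) \<open>x < y\<close> by (simp add: root_above_M_iff)
  qed
  then show ?thesis
    using assms(2) unfolding FP_largest_root_def by (meson not_le_imp_less)
qed

text \<open>As \<open>x\<close> decreases to \<open>M\<close>, the summand of \<open>m\<close> tends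
  to minus infinity while every other summand stays at most its weight
  \<open>\<alpha> q / \<gamma> q\<close>. At the largest present pressure no summand is negative, so
  the intermediate value theorem applies.\<close>

lemma root_above_M_exists:
  assumes m: "m \<in> present" "- Pinf m = M" and "M < P m"
  shows "\<exists>x > M. is_root x"
proof -
  define W where "W = (\<Sum>q\<in>present. \<alpha> q / \<gamma> q)"
  have W: "\<alpha> m / \<gamma> m \<le> W"
    unfolding W_def using weight_pos
    by (intro member_le_sum m(1) finite_present) (auto intro: less_imp_le)
  have wm: "0 < \<alpha> m / \<gamma> m" using m(1) by (rule weight_pos)
  \<comment> \<open>\<open>(x - P q) / (x + Pinf q) \<le> 1\<close> gives
    \<open>F x \<le> W - (\<alpha> m / \<gamma> m) * (P m - M) / (x - M)\<close>; the right-hand side vanishes at \<open>a\<close>.\<close>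
  define a where "a = M + (\<alpha> m / \<gamma> m) * (P m - M) / W"
  have a: "M < a"
    unfolding a_def using wm W assms(3) by (simp del: times_divide_eq_left)
  have term_le: "(a - P q) / (a + Pinf q) * (\<alpha> q / \<gamma> q) \<le> \<alpha> q / \<gamma> q" if "q \<in> present" for q
  proof -
    have "(a - P q) / (a + Pinf q) \<le> 1"
      using denominator_pos[OF that a] pressure_ge[OF that] by simp
    then show ?thesis
      using weight_pos[OF that] mult_right_mono[of "(a - P q) / (a + Pinf q)" 1 "\<alpha> q / \<gamma> q"]
      by simp
  qed
  have "F a = (a - P m) / (a + Pinf m) * (\<alpha> m / \<gamma> m)
      + (\<Sum>q\<in>present - {m}. (a - P q) / (a + Pinf q) * (\<alpha> q / \<gamma> q))"
    unfolding FP_eq_sum_present by (rule sum.remove[OF finite_present m(1)])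
  also have "\<dots> \<le> (a - P m) / (a + Pinf m) * (\<alpha> m / \<gamma> m) + (\<Sum>q\<in>present - {m}. \<alpha> q / \<gamma> q)"
    using term_le by (intro add_left_mono sum_mono) auto
  also have "(\<Sum>q\<in>present - {m}. \<alpha> q / \<gamma> q) = W - \<alpha> m / \<gamma> m"
    unfolding W_def using sum.remove[OF finite_present m(1), of "\<lambda>q. \<alpha> q / \<gamma> q"] by simp
  \<comment> \<open>The choice of \<open>a\<close> makes the quotient equal to
    \<open>1 - W / w\<close>, so this summand exactly cancels the bound on the others.\<close>
  also have "(a - P m) / (a + Pinf m) * (\<alpha> m / \<gamma> m) = \<alpha> m / \<gamma> m - W"
  proof -
    define w where "w = \<alpha> m / \<gamma> m"
    have w: "0 < w" "w \<le> W" using wm W by (simp_all add: w_def)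
    have am: "a + Pinf m = w * (P m - M) / W" using m(2) by (simp add: a_def w_def)
    have "a - P m = (a + Pinf m) - (P m - M)" using m(2) by simp
    then have "(a - P m) / (a + Pinf m) = 1 - (P m - M) / (a + Pinf m)"
      using denominator_pos[OF m(1) a] by (simp only: diff_divide_distrib) simp
    also have "(P m - M) / (a + Pinf m) = W / w"
      unfolding am using w assms(3) by (simp add: field_simps)
    finally have "(a - P m) / (a + Pinf m) = 1 - W / w" .
    moreover have "(1 - W / w) * w = w - W"
      using w by (simp add: left_diff_distrib)
    ultimately show ?thesis by (simp only: w_def)
  qed
  finally have Fa: "F a \<le> 0" by simp
  define b where "b = Max (P ` present)"
  have b: "P q \<le> b" if "q \<in> present" for q
    unfolding b_def using that finite_present by (intro Max_ge) auto
  \<comment> \<open>The weight of \<open>m\<close> is at most the total \<open>W\<close>, hence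
    \<open>a\<close> does not exceed \<open>P m\<close>.\<close>
  have "(\<alpha> m / \<gamma> m) * (P m - M) / W \<le> P m - M"
    using wm W assms(3) mult_right_mono[OF W, of "P m - M"]
    by (subst pos_divide_le_eq) (auto simp: mult.commute)
  then have ab: "a \<le> b"
    using b[OF m(1)] by (simp add: a_def)
  have Fb: "0 \<le> F b"
    unfolding FP_eq_sum_present
    by (intro sum_nonneg mult_nonneg_nonneg[OF divide_nonneg_pos less_imp_le[OF weight_pos]])
      (use b a ab denominator_pos in auto)
  have "continuous_on {a..b} F"
    unfolding FP_eq_sum_present
    by (intro continuous_intros) (use a denominator_pos in force)+
  then obtain x where "a \<le> x" "F x = 0"
    using IVT'[of F a 0 b] Fa Fb ab by blast
  then show ?thesis
    using a by (intro exI[of _ x]) (simp add: root_above_M_iff)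
qed

text \<open>Roots are located among the pressures of present phases; the theorem takes extrema over
  all phases.\<close>

lemma Min_Max_pressure:
  assumes "q \<in> present"
  shows "Min (P ` {1..N}) \<le> P q" and "P q \<le> Max (P ` {1..N})"
  using assms by (auto simp: present_def intro!: Min_le Max_ge)

lemma largest_root_in_pressure_range:
  "\<exists>R. FP_largest_root N \<alpha> \<gamma> P Pinf R \<and> R \<in> {Min (P ` {1..N}) .. Max (P ` {1..N})}"
proof (cases "\<exists>x > M. is_root x")
  case True
  then obtain x where x: "M < x" "is_root x" by blast
  then obtain p r where "p \<in> present" "P p \<le> x" "r \<in> present" "x \<le> P r"
    by (rule root_above_M_between)
  then have "x \<in> {Min (P ` {1..N}) .. Max (P ` {1..N})}"
    using Min_Max_pressure[of p] Min_Max_pressure[of r] by auto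
  with root_above_M_largest[OF x] show ?thesis by blast
next
  case False
  \<comment> \<open>A strict inequality \<open>M < P q\<close> would produce a root above
    \<open>M\<close>, and admissibility excludes \<open>P q < M\<close>.\<close>
  have eq: "P q = M" if "q \<in> present" "- Pinf q = M" for q
    using root_above_M_exists[OF that] pressure_ge[OF that(1)] False that(2) by force
  obtain m where m: "m \<in> present" "- Pinf m = M"
    by (rule M_attained)
  have "is_root M"
    unfolding FP_root_def
  proof (intro conjI)
    show "\<forall>q\<in>{1..N}. \<alpha> q \<noteq> 0 \<longrightarrow> M + Pinf q = 0 \<longrightarrow> M - P q = 0"
      using eq by (auto simp: present_def)
    \<comment> \<open>The denominator of \<open>m\<close> vanishes at \<open>M\<close>, so the
      implication to \<open>F M = 0\<close> holds vacuously.\<close>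
    have "M + Pinf m = 0" using m(2) by simp
    then show "(\<forall>q\<in>{1..N}. \<alpha> q \<noteq> 0 \<longrightarrow> M + Pinf q \<noteq> 0) \<longrightarrow> F M = 0"
      using m(1) by (auto simp: present_def)
  qed
  moreover have "x \<le> M" if "is_root x" for x
    using False that by force
  moreover have "M \<in> {Min (P ` {1..N}) .. Max (P ` {1..N})}"
    using Min_Max_pressure[OF m(1)] eq[OF m] by simp
  ultimately show ?thesis
    unfolding FP_largest_root_def by blast
qed

end

theorem theorem3p2:
  fixes N :: nat and \<alpha> \<gamma> P Pinf :: "nat \<Rightarrow> real"
  assumes "\<And>q. q \<in> {1..N} \<Longrightarrow> 0 \<le> \<alpha> q \<and> \<alpha> q \<le> 1"
    and "(\<Sum>q = 1..N. \<alpha> q) = 1"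
    and "\<And>q. q \<in> {1..N} \<Longrightarrow> \<gamma> q > 1"
    and "\<And>q. q \<in> {1..N} \<Longrightarrow> P q \<ge> Pmin Pinf q"
  shows "\<exists>R. FP_largest_root N \<alpha> \<gamma> P Pinf R \<and>
    R \<in> {Min (P ` {1..N}) .. Max (P ` {1..N})} \<union>
        {Max (Pmin Pinf ` {1..N}) <..< Max (P ` {1..N})}"
proof -
  interpret mixture N \<alpha> \<gamma> P Pinf
    by unfold_locales (use assms in auto)
  show ?thesis
    using largest_root_in_pressure_range by blast
qed

end
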